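(* For every integer $n\geq 3$, $\widetilde{R}_3(\mathcal{T}_{k(n)};n)\leq 5(n-1)$. That is, for every $3$-coloring of $E(K_n)$ hidden from Builder, Builder can, by adaptively querying at most $5(n-1)$ edges, expose a monochromatic tree on $k(n)$ vertices.
   Context: $k(n):=\frac n2+1$ if $n\equiv 2\pmod 4$ and $k(n):=\lceil n/2\rceil$ otherwise. $\mathcal{T}_m$ denotes the family of all trees on $m$ vertices. Restricted online Ramsey number: Painter first picks a coloring $\chi:E(K_n)\to[3]$, hidden from Builder. In each round Builder points to (queries) an edge of $K_n$, chosen depending on the answers so far, and Painter reveals the color of that edge; queried edges are called exposed. For a family of graphs $\mathcal{G}$ such that every $3$-coloring of $E(K_n)$ contains a monochromatic copy of some $G\in\mathcal{G}$ (which is the case for $\mathcal G=\mathcal{T}_{k(n)}$), Builder wins once, for some color $i$, the exposed edges of color $i$ contain a copy of some $G\in\mathcal{G}$. $\widetilde{R}_3(\mathcal{G};n)$ is the least integer $\ell$ for which Builder has a strategy guaranteeing a win with at most $\ell$ queries, regardless of Painter's coloring/strategy. *)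

theory Defs
  imports Complex_Main "HOL-Library.Extended_Nat"
begin

type_synonym 'a edge = "'a set"
type_synonym 'a graph = "'a set \<times> 'a edge set"

definition all_edges :: "'a set \<Rightarrow> 'a edge set" where
  "all_edges V = {e. e \<subseteq> V \<and> card e = 2}"

definition is_graph :: "'a graph \<Rightarrow> bool" where
  "is_graph G \<longleftrightarrow> finite (fst G) \<and> snd G \<subseteq> all_edges (fst G)"

definition connected_graph :: "'a graph \<Rightarrow> bool" where
  "connected_graph G \<longleftrightarrow> fst G \<noteq> {} \<and>
     (\<forall>u\<in>fst G. \<forall>v\<in>fst G. (u, v) \<in> {(x, y). {x, y} \<in> snd G}\<^sup>*)"

text \<open>A cycle is given by the list of its vertices, without repeating the first one at the end.\<close>

definition is_cycle :: "'a graph \<Rightarrow> 'a list \<Rightarrow> bool" where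
  "is_cycle G p \<longleftrightarrow> 3 \<le> length p \<and> distinct p \<and>
     (\<forall>i. Suc i < length p \<longrightarrow> {p ! i, p ! Suc i} \<in> snd G) \<and> {last p, hd p} \<in> snd G"

definition is_tree :: "'a graph \<Rightarrow> bool" where
  "is_tree G \<longleftrightarrow> is_graph G \<and> connected_graph G \<and> \<not> (\<exists>p. is_cycle G p)"

text \<open>Every finite tree is isomorphic to one whose vertices are natural numbers.\<close>

definition trees :: "nat \<Rightarrow> nat graph set" where
  "trees m = {G. is_tree G \<and> card (fst G) = m}"

definition contains_copy :: "'a graph \<Rightarrow> 'b graph \<Rightarrow> bool" where
  "contains_copy H G \<longleftrightarrow>
     (\<exists>f. inj_on f (fst G) \<and> f ` fst G \<subseteq> fst H \<and> (\<forall>e\<in>snd G. f ` e \<in> snd H))"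

text \<open>The complete graph \<open>K\<^sub>n\<close> has vertex set \<open>{..<n}\<close>, and the colors are \<open>{1..r}\<close>.\<close>

definition colorings :: "nat \<Rightarrow> nat \<Rightarrow> (nat edge \<Rightarrow> nat) set" where
  "colorings r n = {\<chi>. \<forall>e\<in>all_edges {..<n}. \<chi> e \<in> {1..r}}"

text \<open>
  A history lists the queried edges with the revealed colors, oldest first. A strategy of Builder
  sees nothing but the history.
\<close>

type_synonym history = "(nat edge \<times> nat) list"
type_synonym strategy = "history \<Rightarrow> nat edge"

fun play :: "strategy \<Rightarrow> (nat edge \<Rightarrow> nat) \<Rightarrow> nat \<Rightarrow> history" where
  "play \<sigma> \<chi> 0 = []"
| "play \<sigma> \<chi> (Suc t) = (let h = play \<sigma> \<chi> t; e = \<sigma> h in h @ [(e, \<chi> e)])"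

definition exposed :: "nat \<Rightarrow> history \<Rightarrow> nat \<Rightarrow> nat graph" where
  "exposed n h i = ({..<n}, {e. (e, i) \<in> set h})"

definition won :: "nat \<Rightarrow> 'a graph set \<Rightarrow> nat \<Rightarrow> history \<Rightarrow> bool" where
  "won r \<G> n h \<longleftrightarrow> (\<exists>i\<in>{1..r}. \<exists>G\<in>\<G>. contains_copy (exposed n h i) G)"

text \<open>
  The strategy is chosen before the coloring. Its queries have to be edges of \<open>K\<^sub>n\<close> up to
  the winning round; querying an edge again is legal, but counts as a query.
\<close>

definition builder_wins_within :: "nat \<Rightarrow> 'a graph set \<Rightarrow> nat \<Rightarrow> nat \<Rightarrow> bool" where
  "builder_wins_within r \<G> n l \<longleftrightarrow>
     (\<exists>\<sigma>. \<forall>\<chi>\<in>colorings r n. \<exists>t\<le>l.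
        (\<forall>s<t. \<sigma> (play \<sigma> \<chi> s) \<in> all_edges {..<n}) \<and> won r \<G> n (play \<sigma> \<chi> t))"

text \<open>
  The infimum is taken in \<^typ>\<open>enat\<close>, so that it is \<open>\<infinity>\<close> if Builder has no winning strategy,
  and otherwise the least number of queries.
\<close>

definition restricted_online_ramsey :: "nat \<Rightarrow> 'a graph set \<Rightarrow> nat \<Rightarrow> enat" where
  "restricted_online_ramsey r \<G> n = (INF l\<in>{l. builder_wins_within r \<G> n l}. enat l)"

definition k :: "nat \<Rightarrow> nat" where
  "k n = (if n mod 4 = 2 then n div 2 + 1 else nat \<lceil>real n / 2\<rceil>)"

end

theory Submission
  imports Defs
begin

text \<open>
  Builder only queries pairs \<open>{u, v}\<close> such that, for every color \<open>i\<close>, the vertices \<open>u\<close> and \<open>v\<close> lie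
  in different components of the graph of exposed edges of color \<open>i\<close>. Whatever the answer is, the
  query then merges two components of the color that is revealed. With three colors there are
  \<open>3n\<close> components at the start and at least three at any time, so after at most
  \<open>3(n - 1)\<close> queries no such pair is left (\<open>merging_strategy_reaches_stuck\<close>). This is well
  within the bound \<open>5(n - 1)\<close>.

  At that moment any two vertices lie in a common exposed component of some color. Send each vertex
  to the triple of its three components: the triples form a 3-partite 3-uniform hypergraph in which
  any two edges meet. Such a hypergraph has a vertex cover of size two (\<open>intersecting_cover\<close>; this
  is the intersecting case of Ryser's conjecture for \<open>r = 3\<close>), that is, two exposed monochromatic
  components cover all vertices, and the larger one has at least \<open>n/2\<close> of them.

  This is enough unless \<open>n = 2s\<close> with \<open>s\<close> odd, where \<open>s + 1\<close> vertices are needed. If no component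
  has that many, then the two components of the cover are complementary halves \<open>A\<close> and \<open>B\<close> of size
  \<open>s\<close>. Every pair across shares a component in one of the colors other than those of \<open>A\<close> and
  \<open>B\<close>, and \<open>bipartite_large_class\<close> derives from this that \<open>s\<close> is even.

  Finally, a component with at least \<open>k(n)\<close> vertices contains a tree with exactly \<open>k(n)\<close> vertices,
  which is grown leaf by leaf (\<open>ex_subtree_of_component\<close>).
\<close>

section \<open>Subtrees of prescribed size\<close>

abbreviation adjacency :: "'a edge set \<Rightarrow> ('a \<times> 'a) set" where
  "adjacency F \<equiv> {(x, y). {x, y} \<in> F}"

lemma sym_rtrancl_adjacency: "sym ((adjacency F)\<^sup>*)"
  by (rule sym_rtrancl) (auto simp: sym_def insert_commute)

lemma is_cycle_cyclic_edge:
  assumes "is_cycle G p" "j < length p"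
  shows "{p ! j, p ! (Suc j mod length p)} \<in> snd G"
proof (cases "Suc j < length p")
  case True
  then show ?thesis using assms by (simp add: is_cycle_def)
next
  case False
  then have "Suc j = length p" using assms by simp
  then have "p \<noteq> []" "j = length p - 1" by auto
  then have "last p = p ! j" "hd p = p ! 0" by (simp_all add: last_conv_nth hd_conv_nth)
  then show ?thesis using assms \<open>Suc j = length p\<close> by (simp add: is_cycle_def)
qed

text \<open>
  A cycle through the new vertex would need two distinct neighbours of it, but it has only one.
\<close>

lemma is_tree_add_leaf:
  assumes tree: "is_tree (T, F)" and "x \<in> T" "y \<notin> T"
  shows "is_tree (insert y T, insert {x, y} F)"
proof -
  let ?F = "insert {x, y} F"
  have F: "F \<subseteq> all_edges T" and "finite T"
    using tree by (auto simp: is_tree_def is_graph_def)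
  have graph: "is_graph (insert y T, ?F)"
    using F \<open>finite T\<close> assms(2,3) by (auto simp: is_graph_def all_edges_def card_2_iff)
  have to_x: "(u, x) \<in> (adjacency ?F)\<^sup>*" if "u \<in> insert y T" for u
  proof (cases "u = y")
    case True
    then show ?thesis by (auto simp: insert_commute)
  next
    case False
    then have "(u, x) \<in> (adjacency F)\<^sup>*"
      using tree that assms(2) by (auto simp: is_tree_def connected_graph_def)
    then show ?thesis by (rule rtrancl_mono[THEN subsetD, rotated]) auto
  qed
  have conn: "connected_graph (insert y T, ?F)"
    unfolding connected_graph_def
    using to_x sym_rtrancl_adjacency[of ?F] by (auto dest: symD intro: rtrancl_trans)
  have y_edge: "e = {x, y}" if "e \<in> ?F" "y \<in> e" for e
    using that F assms(3) by (auto simp: all_edges_def)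
  have "\<not> is_cycle (insert y T, ?F) p" for p
  proof
    assume p: "is_cycle (insert y T, ?F) p"
    let ?L = "length p"
    have L: "3 \<le> ?L" and dist: "distinct p" using p by (auto simp: is_cycle_def)
    show False
    proof (cases "y \<in> set p")
      case False
      have "e \<in> F" if "e \<in> ?F" "y \<notin> e" for e
        using that by auto
      moreover have "y \<noteq> p ! i" if "i < ?L" for i
        using that False by auto
      moreover have "y \<noteq> last p" "y \<noteq> hd p"
        using False L by (metis last_in_set hd_in_set list.size(3) not_numeral_le_zero)+
      ultimately have "is_cycle (T, F) p"
        using p by (simp add: is_cycle_def) (metis Suc_lessD doubleton_eq_iff)
      then show False using tree by (auto simp: is_tree_def)
    next
      case True
      \<comment> \<open>The positions \<open>a\<close> and \<open>b\<close> just before and after \<open>y\<close> on the cycle both have to carry \<open>x\<close>.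
        They differ because the cycle has length at least three.\<close>
      then obtain j where j: "j < ?L" "p ! j = y" by (auto simp: in_set_conv_nth)
      define a b where "a = (if j = 0 then ?L - 1 else j - 1)" and "b = Suc j mod ?L"
      have a: "a < ?L" "Suc a mod ?L = j" "a \<noteq> j" and b: "b < ?L" "b \<noteq> j" "a \<noteq> b"
        using j(1) L by (auto simp: a_def b_def mod_Suc split: if_splits)
      have "{p ! a, y} \<in> ?F" "{y, p ! b} \<in> ?F"
        using is_cycle_cyclic_edge[OF p a(1)] is_cycle_cyclic_edge[OF p j(1)]
        by (simp_all only: a(2) j(2) b_def snd_conv)
      then have "{p ! a, y} = {x, y}" "{y, p ! b} = {x, y}" using y_edge by blast+
      then have "p ! a = p ! b" by (metis doubleton_eq_iff)
      then show False using dist a b by (simp add: nth_eq_iff_index_eq)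
    qed
  qed
  then show ?thesis using graph conn by (auto simp: is_tree_def)
qed

lemma is_tree_single: "is_tree ({u}, {})"
  by (auto simp: is_tree_def is_graph_def connected_graph_def is_cycle_def)

text \<open>
  A subtree that contains \<open>u\<close> but not its whole component is not closed under adjacency, so there is
  an edge along which it can be extended by a leaf.
\<close>

lemma ex_subtree_of_component:
  assumes "1 \<le> m" "m \<le> card ((adjacency F)\<^sup>* `` {u})"
  shows "\<exists>T F'. u \<in> T \<and> T \<subseteq> (adjacency F)\<^sup>* `` {u} \<and> F' \<subseteq> F \<and> is_tree (T, F') \<and> card T = m"
  using assms
proof (induction m rule: dec_induct)
  case base
  show ?case using is_tree_single[of u] by (intro exI[of _ "{u}"] exI[of _ "{}"]) auto
next
  case (step m)
  let ?S = "(adjacency F)\<^sup>* `` {u}"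
  obtain T F' where T: "u \<in> T" "T \<subseteq> ?S" "F' \<subseteq> F" "is_tree (T, F')" "card T = m"
    using step by auto
  have "finite T" using T(4) by (auto simp: is_tree_def is_graph_def)
  have "\<exists>x\<in>T. \<exists>y. y \<notin> T \<and> {x, y} \<in> F"
  proof (rule ccontr)
    assume closed: "\<not> ?thesis"
    have "w \<in> T" if "(u, w) \<in> (adjacency F)\<^sup>*" for w
      using that by (induction rule: rtrancl_induct) (use T(1) closed in auto)
    then have "?S \<subseteq> T" by auto
    then have "card ?S \<le> m" using \<open>finite T\<close> T(5) card_mono by blast
    then show False using step.prems by simp
  qed
  then obtain x y where xy: "x \<in> T" "y \<notin> T" "{x, y} \<in> F" by auto
  then have "y \<in> ?S" using T(2) by (auto intro: rtrancl_into_rtrancl)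
  then show ?case
    using is_tree_add_leaf[OF T(4) xy(1,2)] T xy \<open>finite T\<close>
    by (intro exI[of _ "insert y T"] exI[of _ "insert {x, y} F'"]) auto
qed

section \<open>Three labelings that agree on every pair\<close>

text \<open>
  Labels play the part of hypergraph vertices. Let \<open>s\<close> and \<open>t\<close> agree under \<open>f\<close> only. A point with
  another \<open>f\<close>-label than theirs must agree with \<open>s\<close> under one of \<open>g\<close> and \<open>h\<close>, and with \<open>t\<close> under
  the other. If only one of these two forms occurs, a \<open>g\<close>-label covers all such points. If both
  occur, points of different forms can only agree under \<open>f\<close>, so all of them have one common
  \<open>f\<close>-label.
\<close>

lemma cover_of_single_agreement:
  assumes share: "\<And>u v. u \<in> V \<Longrightarrow> v \<in> V \<Longrightarrow> f u = f v \<or> g u = g v \<or> h u = h v"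
    and "s \<in> V" "t \<in> V" "f s = f t" "g s \<noteq> g t" "h s \<noteq> h t"
  shows "(\<exists>q\<in>V. \<forall>v\<in>V. f v = f s \<or> g v = g q) \<or> (\<exists>q\<in>V. \<forall>v\<in>V. f v = f s \<or> f v = f q)"
proof -
  have two_forms: "g v = g s \<and> h v = h t \<or> g v = g t \<and> h v = h s" if "v \<in> V" "f v \<noteq> f s" for v
    using share[of v s] share[of v t] that assms(2-6) by metis
  show ?thesis
  proof (cases "\<exists>p\<in>V. \<exists>q\<in>V. f p \<noteq> f s \<and> g p = g s \<and> f q \<noteq> f s \<and> g q = g t")
    case True
    then obtain p q where pq: "p \<in> V" "q \<in> V" "f p \<noteq> f s" "g p = g s" "f q \<noteq> f s" "g q = g t"
      by blast
    have forms: "h p = h t" "h q = h s"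
      using two_forms[OF pq(1,3)] two_forms[OF pq(2,5)] pq(4,6) assms(5) by auto
    have "f p = f q"
      using share[OF pq(1,2)] forms pq(4,6) assms(5,6) by auto
    moreover have "f v = f p \<or> f v = f q" if "v \<in> V" "f v \<noteq> f s" for v
      using two_forms[OF that] share[OF that(1) pq(1)] share[OF that(1) pq(2)] forms pq(4,6) assms(5,6)
      by auto
    ultimately have "f v = f s \<or> f v = f p" if "v \<in> V" for v
      using that by metis
    then show ?thesis using pq(1) by blast
  next
    case False
    then show ?thesis using two_forms assms(2,3) by metis
  qed
qed

text \<open>
  If no two points agree under exactly one labeling, then every point agrees with a fixed one under
  at least two labelings, and any two labels of the fixed point form a cover.
\<close>

lemma intersecting_cover:
  fixes f :: "nat \<Rightarrow> 'v \<Rightarrow> 'l"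
  assumes share: "\<And>u v. u \<in> V \<Longrightarrow> v \<in> V \<Longrightarrow> \<exists>i\<in>{1..3}. f i u = f i v" and "V \<noteq> {}"
  shows "\<exists>i\<in>{1..3}. \<exists>j\<in>{1..3}. \<exists>p\<in>V. \<exists>q\<in>V. \<forall>v\<in>V. f i v = f i p \<or> f j v = f j q"
proof -
  have three: "{1..3} = {1, 2, 3::nat}" by auto
  have sh: "f 1 u = f 1 v \<or> f 2 u = f 2 v \<or> f 3 u = f 3 v" if "u \<in> V" "v \<in> V" for u v
    using share[OF that] unfolding three by simp
  show ?thesis
  proof (cases "\<exists>s\<in>V. \<exists>t\<in>V. \<exists>i j l. {i, j, l} = {1, 2, 3} \<and>
      f i s = f i t \<and> f j s \<noteq> f j t \<and> f l s \<noteq> f l t")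
    case True
    then obtain s t i j l where st: "s \<in> V" "t \<in> V" and ijl: "{i, j, l} = {1, 2, 3}"
      and one: "f i s = f i t" "f j s \<noteq> f j t" "f l s \<noteq> f l t"
      by blast
    have "f i u = f i v \<or> f j u = f j v \<or> f l u = f l v" if "u \<in> V" "v \<in> V" for u v
      using share[OF that] unfolding three ijl[symmetric] by auto
    from cover_of_single_agreement[of V "f i" "f j" "f l", OF this st one]
    show ?thesis unfolding three ijl[symmetric] using st(1) by blast
  next
    case False
    obtain s where s: "s \<in> V" using \<open>V \<noteq> {}\<close> by auto
    have "f 1 v = f 1 s \<or> f 2 v = f 2 s" if "v \<in> V" for v
    proof (rule ccontr)
      assume "\<not> ?thesis"
      then have "{3, 1, 2} = {1, 2, 3::nat} \<and> f 3 v = f 3 s \<and> f 1 v \<noteq> f 1 s \<and> f 2 v \<noteq> f 2 s"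
        using sh[OF that s] by auto
      then show False using False that s by blast
    qed
    then show ?thesis using s unfolding three by blast
  qed
qed

text \<open>
  Suppose that all classes have at most \<open>s\<close> points. Then no class contains one side together with a
  point of the other side. This forces exactly two pairs of labels on each side, arranged so that \<open>A\<close>
  and \<open>B\<close> split as \<open>A1 \<union> A2\<close> and \<open>B1 \<union> B2\<close>, with \<open>A1 \<union> B1\<close> and \<open>A2 \<union> B2\<close> inside classes of
  \<open>g\<close>, and \<open>A1 \<union> B2\<close> and \<open>A2 \<union> B1\<close> inside classes of \<open>h\<close>. Each of these
  two partitions of \<open>A \<union> B\<close> has two parts of at most half the size, so all four parts have size \<open>s\<close>.
  Hence \<open>B1\<close> and \<open>B2\<close> have the same size and \<open>s\<close> is even. Oddness is essential: four equal sets
  \<open>A1\<close>, \<open>A2\<close>, \<open>B1\<close>, \<open>B2\<close> labeled in this way are a counterexample for even \<open>s\<close>.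
\<close>

lemma bipartite_large_class:
  assumes fin: "finite A" "finite B" and disj: "A \<inter> B = {}"
    and card: "card A = s" "card B = s" and "odd s"
    and share: "\<And>a b. a \<in> A \<Longrightarrow> b \<in> B \<Longrightarrow> g a = g b \<or> h a = h b"
  shows "\<exists>u\<in>A \<union> B. s < card {v \<in> A \<union> B. g v = g u} \<or> s < card {v \<in> A \<union> B. h v = h u}"
proof (rule ccontr)
  assume "\<not> ?thesis"
  then have g_le: "card {v \<in> A \<union> B. g v = g u} \<le> s" and h_le: "card {v \<in> A \<union> B. h v = h u} \<le> s"
    if "u \<in> A \<union> B" for u
    using that by (auto simp: not_less)
  have not_side_and_point: False if "X = A \<and> Y = B \<or> X = B \<and> Y = A" "y \<in> Y"
    "(\<forall>v\<in>X. g v = g y) \<or> (\<forall>v\<in>X. h v = h y)" for X Y y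
  proof -
    have "insert y X \<subseteq> {v \<in> A \<union> B. g v = g y} \<or> insert y X \<subseteq> {v \<in> A \<union> B. h v = h y}"
      using that by auto
    then have "card (insert y X) \<le> s"
    proof
      assume "insert y X \<subseteq> {v \<in> A \<union> B. g v = g y}"
      then have "card (insert y X) \<le> card {v \<in> A \<union> B. g v = g y}"
        using fin by (intro card_mono) auto
      then show ?thesis using g_le[of y] that(1,2) by auto
    next
      assume "insert y X \<subseteq> {v \<in> A \<union> B. h v = h y}"
      then have "card (insert y X) \<le> card {v \<in> A \<union> B. h v = h y}"
        using fin by (intro card_mono) auto
      then show ?thesis using h_le[of y] that(1,2) by auto
    qed
    moreover have "card (insert y X) = Suc s"
      using that(1,2) disj fin card by (auto simp: card_insert_if)
    ultimately show False by simp
  qed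
  \<comment> \<open>Some point of \<open>B\<close> misses the \<open>g\<close>-label of \<open>a\<close> and another one its \<open>h\<close>-label. Comparison
    with these two leaves only two pairs of labels for the points of \<open>A\<close>, and likewise for \<open>B\<close>.\<close>
  obtain a where a: "a \<in> A" using card \<open>odd s\<close> by (metis card.empty all_not_in_conv even_zero)
  obtain b1 where b1: "b1 \<in> B" "g b1 \<noteq> g a" using not_side_and_point[of B A a] a by blast
  obtain b2 where b2: "b2 \<in> B" "h b2 \<noteq> h a" using not_side_and_point[of B A a] a by blast
  have eqs: "h b1 = h a" "g b2 = g a" using share[OF a] b1 b2 by metis+
  have A_forms: "g v = g a \<and> h v = h a \<or> g v = g b1 \<and> h v = h b2" if "v \<in> A" for v
    using share[OF that b1(1)] share[OF that b2(1)] eqs b1 b2 by metis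
  obtain a2 where a2: "a2 \<in> A" "h a2 \<noteq> h a" using not_side_and_point[of A B b1] b1 eqs by metis
  have B_forms: "g v = g a \<and> h v = h b2 \<or> g v = g b1 \<and> h v = h a" if "v \<in> B" for v
    using share[OF a that] share[OF a2(1) that] A_forms[OF a2(1)] a2 b1 b2 by metis
  define A1 A2 B1 B2 where "A1 = {v \<in> A. g v = g a}" and "A2 = {v \<in> A. g v \<noteq> g a}"
    and "B1 = {v \<in> B. g v = g a}" and "B2 = {v \<in> B. g v \<noteq> g a}"
  note defs = A1_def A2_def B1_def B2_def
  have fins: "finite A1" "finite A2" "finite B1" "finite B2" using fin by (auto simp: defs)
  have "A = A1 \<union> A2" "A1 \<inter> A2 = {}" by (auto simp: defs)
  then have A: "card A1 + card A2 = s"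
    using fins card card_Un_disjoint[of A1 A2] by metis
  have "B = B1 \<union> B2" "B1 \<inter> B2 = {}" by (auto simp: defs)
  then have B: "card B1 + card B2 = s"
    using fins card card_Un_disjoint[of B1 B2] by metis
  have le: "card X + card Y \<le> s"
    if "u \<in> A \<union> B" "X \<subseteq> A" "Y \<subseteq> B" "(\<forall>v\<in>X \<union> Y. g v = g u) \<or> (\<forall>v\<in>X \<union> Y. h v = h u)" for X Y u
  proof -
    have "card X + card Y = card (X \<union> Y)"
      using that(2,3) fin disj by (intro card_Un_disjoint[symmetric]) (auto intro: finite_subset)
    also have "\<dots> \<le> s"
      using that(4)
    proof
      assume "\<forall>v\<in>X \<union> Y. g v = g u"
      then have "card (X \<union> Y) \<le> card {v \<in> A \<union> B. g v = g u}"
        using that(2,3) fin by (intro card_mono) auto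
      then show ?thesis using g_le[OF that(1)] by simp
    next
      assume "\<forall>v\<in>X \<union> Y. h v = h u"
      then have "card (X \<union> Y) \<le> card {v \<in> A \<union> B. h v = h u}"
        using that(2,3) fin by (intro card_mono) auto
      then show ?thesis using h_le[OF that(1)] by simp
    qed
    finally show ?thesis .
  qed
  have sub: "A1 \<subseteq> A" "A2 \<subseteq> A" "B1 \<subseteq> B" "B2 \<subseteq> B" by (auto simp: defs)
  have A1_labels: "g v = g a \<and> h v = h a" if "v \<in> A1" for v
    using A_forms[of v] that b1(2) unfolding defs by auto
  have A2_labels: "g v = g b1 \<and> h v = h b2" if "v \<in> A2" for v
    using A_forms[of v] that by (simp add: defs)
  have B1_labels: "g v = g a \<and> h v = h b2" if "v \<in> B1" for v
    using B_forms[of v] that b1(2) unfolding defs by auto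
  have B2_labels: "g v = g b1 \<and> h v = h a" if "v \<in> B2" for v
    using B_forms[of v] that by (simp add: defs)
  have "card A1 + card B1 \<le> s"
    using le[of a A1 B1] a sub A1_labels B1_labels by blast
  moreover have "card A2 + card B2 \<le> s"
    using le[of b1 A2 B2] b1 sub A2_labels B2_labels by blast
  moreover have "card A1 + card B2 \<le> s"
    using le[of a A1 B2] a sub A1_labels B2_labels by blast
  moreover have "card A2 + card B1 \<le> s"
    using le[of b2 A2 B1] b2 sub A2_labels B1_labels by blast
  ultimately have "s = 2 * card B1" using A B by linarith
  then show False using \<open>odd s\<close> by simp
qed

lemma k_altdef: "k n = (if n mod 4 = 2 then n div 2 + 1 else (n + 1) div 2)"
proof -
  have "\<lceil>real n / 2\<rceil> = (int n + 1) div 2"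
    by (rule ceiling_unique) linarith+
  then show ?thesis by (auto simp: k_def nat_div_distrib nat_add_distrib)
qed

text \<open>
  If all classes are too small, the two classes of the cover are disjoint halves of odd size. Points
  in different halves disagree under the labelings \<open>i\<close> and \<open>j\<close> of the cover, so they agree under one
  of the remaining ones.
\<close>

lemma ex_large_class:
  fixes f :: "nat \<Rightarrow> 'v \<Rightarrow> 'l"
  assumes share: "\<And>u v. u \<in> V \<Longrightarrow> v \<in> V \<Longrightarrow> \<exists>i\<in>{1..3}. f i u = f i v"
    and "V \<noteq> {}" "finite V"
  shows "\<exists>i\<in>{1..3}. \<exists>u\<in>V. k (card V) \<le> card {v \<in> V. f i v = f i u}"
proof (rule ccontr)
  assume "\<not> ?thesis"
  then have small: "card {v \<in> V. f i v = f i u} < k (card V)" if "i \<in> {1..3}" "u \<in> V" for i u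
    using that by (auto simp: not_le)
  obtain i j p q where ij: "i \<in> {1..3}" "j \<in> {1..3}" and pq: "p \<in> V" "q \<in> V"
    and cover: "\<And>v. v \<in> V \<Longrightarrow> f i v = f i p \<or> f j v = f j q"
    using intersecting_cover[of V f, OF share \<open>V \<noteq> {}\<close>] by blast
  define A B where "A = {v \<in> V. f i v = f i p}" and "B = {v \<in> V. f j v = f j q}"
  have V: "V = A \<union> B" using cover by (auto simp: A_def B_def)
  have fin: "finite A" "finite B" using \<open>finite V\<close> V by auto
  have AB: "card A < k (card V)" "card B < k (card V)"
    using small ij pq by (auto simp: A_def B_def)
  have un: "card V + card (A \<inter> B) = card A + card B" using card_Un_Int[OF fin] V by simp
  define s where "s = card V div 2"
  \<comment> \<open>The cover excludes all residues modulo 4 but 2: two classes smaller than \<open>k (card V)\<close> have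
    fewer than \<open>card V\<close> points together in the other cases.\<close>
  have n: "card V = 2 * s" "odd s" and k: "k (card V) = s + 1"
    using AB un by (auto simp: s_def k_altdef split: if_splits; presburger)+
  then have card: "card A = s" "card B = s" and "card (A \<inter> B) = 0" using AB un by linarith+
  then have disj: "A \<inter> B = {}" using fin by auto
  have outside: "f i a \<noteq> f i b \<and> f j a \<noteq> f j b" if "a \<in> A" "b \<in> B" for a b
  proof -
    have "a \<in> V" "b \<in> V" "a \<notin> B" "b \<notin> A" using that disj V by auto
    then show ?thesis using that by (simp add: A_def B_def)
  qed
  have three: "{1..3} = {1, 2, 3::nat}" by auto
  \<comment> \<open>If \<open>i \<noteq> j\<close>, only one labeling remains, and it serves as both \<open>g\<close> and \<open>h\<close>.\<close>
  obtain g h where gh: "g \<in> {1..3}" "h \<in> {1..3}" "{1..3} \<subseteq> {i, j, g, h}"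
  proof (cases "i = j")
    case True
    then show ?thesis
      using ij that[of 2 3] that[of 1 3] that[of 1 2] unfolding three by blast
  next
    case False
    then show ?thesis
      using ij that[of 1 1] that[of 2 2] that[of 3 3] unfolding three by blast
  qed
  have "f g a = f g b \<or> f h a = f h b" if "a \<in> A" "b \<in> B" for a b
    using share[of a b] outside[OF that] that gh(3) V by blast
  from bipartite_large_class[OF fin disj card \<open>odd s\<close> this]
  show False using small gh(1,2) k unfolding V[symmetric] by force
qed

section \<open>Queries that always merge two components\<close>

definition color_comp :: "history \<Rightarrow> nat \<Rightarrow> nat \<Rightarrow> nat set" where
  "color_comp h i u = (adjacency {e. (e, i) \<in> set h})\<^sup>* `` {u}"

definition merging :: "nat \<Rightarrow> nat \<Rightarrow> history \<Rightarrow> nat edge \<Rightarrow> bool" where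
  "merging r n h e \<longleftrightarrow> (\<exists>u<n. \<exists>v<n. e = {u, v} \<and> u \<noteq> v \<and> (\<forall>i\<in>{1..r}. color_comp h i u \<noteq> color_comp h i v))"

definition merging_strategy :: "nat \<Rightarrow> nat \<Rightarrow> strategy" where
  "merging_strategy r n h = (SOME e. merging r n h e)"

definition num_comps :: "nat \<Rightarrow> history \<Rightarrow> nat \<Rightarrow> nat" where
  "num_comps n h i = card (color_comp h i ` {..<n})"

lemma num_comps_snoc_other:
  assumes "j \<noteq> i"
  shows "num_comps n (h @ [(e, i)]) j = num_comps n h j"
  using assms by (simp add: num_comps_def color_comp_def)

text \<open>
  The new components are the images of the old ones under reachability in the larger graph, and this
  map from old to new components identifies the components of \<open>u\<close> and \<open>v\<close>.
\<close>

lemma num_comps_snoc_less: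
  assumes "u < n" "v < n" "color_comp h i u \<noteq> color_comp h i v"
  shows "num_comps n (h @ [({u, v}, i)]) i < num_comps n h i"
proof -
  let ?h = "h @ [({u, v}, i)]"
  let ?R = "adjacency {e. (e, i) \<in> set h}" and ?R' = "adjacency {e. (e, i) \<in> set ?h}"
  have "?R\<^sup>* O ?R'\<^sup>* = ?R'\<^sup>*"
  proof
    have "?R\<^sup>* \<subseteq> ?R'\<^sup>*" by (rule rtrancl_mono) auto
    then show "?R\<^sup>* O ?R'\<^sup>* \<subseteq> ?R'\<^sup>*" by (auto intro: rtrancl_trans)
  qed auto
  then have ext: "color_comp ?h i w = ?R'\<^sup>* `` color_comp h i w" for w
    unfolding color_comp_def by (metis relcomp_Image)
  have uv: "(u, v) \<in> ?R'\<^sup>*" "(v, u) \<in> ?R'\<^sup>*" by (auto simp: insert_commute)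
  then have "color_comp ?h i u = color_comp ?h i v"
    unfolding color_comp_def by (auto intro: rtrancl_trans)
  then have "?R'\<^sup>* `` color_comp h i u = ?R'\<^sup>* `` color_comp h i v" by (metis ext)
  then have "\<not> inj_on (Image (?R'\<^sup>*)) (color_comp h i ` {..<n})"
    using assms unfolding inj_on_def by blast
  moreover have "color_comp ?h i ` {..<n} = Image (?R'\<^sup>*) ` color_comp h i ` {..<n}"
    by (simp add: ext image_image)
  ultimately show ?thesis
    unfolding num_comps_def
    by (metis card_image_le eq_card_imp_inj_on finite_imageI finite_lessThan le_neq_implies_less)
qed

text \<open>
  The total number of components over all colors is at most \<open>r * n\<close> at the start, drops with every
  merging query, and never falls below \<open>r\<close>.
\<close>

lemma merging_strategy_reaches_stuck:
  assumes \<chi>: "\<chi> \<in> colorings r n" and "0 < n"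
  shows "\<exists>t\<le>r * (n - 1). (\<forall>s<t. merging_strategy r n (play (merging_strategy r n) \<chi> s) \<in> all_edges {..<n})
    \<and> (\<forall>e. \<not> merging r n (play (merging_strategy r n) \<chi> t) e)"
proof -
  let ?\<sigma> = "merging_strategy r n"
  let ?h = "play ?\<sigma> \<chi>"
  have merge: "merging r n (?h s) (?\<sigma> (?h s))" if "\<exists>e. merging r n (?h s) e" for s
    using that unfolding merging_strategy_def by (rule someI_ex)
  have edge: "e \<in> all_edges {..<n}" if "merging r n h e" for h e
    using that by (auto simp: merging_def all_edges_def)
  have drop: "(\<Sum>i=1..r. num_comps n (?h t) i) + t \<le> r * n"
    if "\<forall>s<t. \<exists>e. merging r n (?h s) e" for t
    using that
  proof (induction t)
    case 0
    have "num_comps n [] i \<le> n" for i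
      unfolding num_comps_def using card_image_le[of "{..<n}"] by simp
    then have "(\<Sum>i=1..r. num_comps n [] i) \<le> (\<Sum>i=1..r. n)" by (intro sum_mono)
    then show ?case by simp
  next
    case (Suc t)
    define e where "e = ?\<sigma> (?h t)"
    have m: "merging r n (?h t) e" using Suc.prems merge by (auto simp: e_def)
    then obtain u v where uv: "u < n" "v < n" "e = {u, v}"
      "\<forall>i\<in>{1..r}. color_comp (?h t) i u \<noteq> color_comp (?h t) i v"
      by (auto simp: merging_def)
    have c: "\<chi> e \<in> {1..r}" using \<chi> edge[OF m] by (auto simp: colorings_def)
    have step: "?h (Suc t) = ?h t @ [(e, \<chi> e)]" by (simp add: e_def Let_def)
    have less: "num_comps n (?h (Suc t)) (\<chi> e) < num_comps n (?h t) (\<chi> e)"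
      using num_comps_snoc_less[of u n v "?h t" "\<chi> e"] uv c unfolding step by simp
    have "(\<Sum>i=1..r. num_comps n (?h (Suc t)) i) < (\<Sum>i=1..r. num_comps n (?h t) i)"
    proof (rule sum_strict_mono_ex1)
      show "\<forall>i\<in>{1..r}. num_comps n (?h (Suc t)) i \<le> num_comps n (?h t) i"
        using less num_comps_snoc_other unfolding step by (metis less_imp_le order_refl)
      show "\<exists>i\<in>{1..r}. num_comps n (?h (Suc t)) i < num_comps n (?h t) i"
        using less c by blast
    qed simp
    then show ?case using Suc by fastforce
  qed
  have bound: "t \<le> r * (n - 1)" if "\<forall>s<t. \<exists>e. merging r n (?h s) e" for t
  proof -
    have "1 \<le> num_comps n (?h t) i" for i
      using \<open>0 < n\<close> by (auto simp: num_comps_def Suc_le_eq card_gt_0_iff)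
    then have "(\<Sum>i=1..r. 1) \<le> (\<Sum>i=1..r. num_comps n (?h t) i)" by (intro sum_mono)
    then have "r + t \<le> r * n" using drop[OF that] by simp
    then show ?thesis by (simp add: diff_mult_distrib2)
  qed
  let ?P = "\<lambda>t. \<forall>e. \<not> merging r n (?h t) e"
  have "\<exists>t. ?P t" using bound[of "Suc (r * (n - 1))"] by auto
  then have "?P (LEAST t. ?P t)" by (rule LeastI_ex)
  moreover have before: "\<forall>s<(LEAST t. ?P t). \<exists>e. merging r n (?h s) e"
    using not_less_Least by blast
  ultimately show ?thesis using bound[OF before] merge edge by blast
qed

lemma set_play: "set (play \<sigma> \<chi> t) = (\<lambda>s. (\<sigma> (play \<sigma> \<chi> s), \<chi> (\<sigma> (play \<sigma> \<chi> s)))) ` {..<t}"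
  by (induction t) (auto simp: Let_def lessThan_Suc)

lemma color_comp_subset:
  assumes edges: "\<And>e i. (e, i) \<in> set h \<Longrightarrow> e \<in> all_edges {..<n}" and "u < n"
  shows "color_comp h i u \<subseteq> {..<n}"
proof -
  have "v < n" if "(u, v) \<in> (adjacency {e. (e, i) \<in> set h})\<^sup>*" for v
    using that by (induction rule: rtrancl_induct) (use assms in \<open>auto simp: all_edges_def\<close>)
  then show ?thesis by (auto simp: color_comp_def)
qed

lemma won_of_large_comp:
  assumes edges: "\<And>e i. (e, i) \<in> set h \<Longrightarrow> e \<in> all_edges {..<n}"
    and "i \<in> {1..r}" "u < n" "1 \<le> m" "m \<le> card (color_comp h i u)"
  shows "won r (trees m) n h"
proof -
  let ?F = "{e. (e, i) \<in> set h}"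
  have inV: "color_comp h i u \<subseteq> {..<n}" by (rule color_comp_subset[OF edges \<open>u < n\<close>])
  obtain T F' where T: "T \<subseteq> color_comp h i u" "F' \<subseteq> ?F" "is_tree (T, F')" "card T = m"
    using ex_subtree_of_component[of m ?F u] assms(4,5) by (auto simp: color_comp_def)
  have "contains_copy (exposed n h i) (T, F')"
    unfolding contains_copy_def
    by (rule exI[of _ id]) (use T inV in \<open>auto simp: exposed_def\<close>)
  then show ?thesis
    using T assms(2) unfolding won_def trees_def
    by (intro bexI[of _ i] bexI[of _ "(T, F')"]) simp_all
qed

theorem theorem3:
  fixes n :: nat
  assumes "3 \<le> n"
  shows "restricted_online_ramsey 3 (trees (k n)) n \<le> enat (5 * (n - 1))"
proof -
  have "0 < n" using assms by simp
  let ?\<sigma> = "merging_strategy 3 n"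
  have "\<exists>t\<le>5 * (n - 1). (\<forall>s<t. ?\<sigma> (play ?\<sigma> \<chi> s) \<in> all_edges {..<n}) \<and> won 3 (trees (k n)) n (play ?\<sigma> \<chi> t)"
    if \<chi>: "\<chi> \<in> colorings 3 n" for \<chi>
  proof -
    obtain t where t: "t \<le> 3 * (n - 1)" and legal: "\<forall>s<t. ?\<sigma> (play ?\<sigma> \<chi> s) \<in> all_edges {..<n}"
      and stuck: "\<forall>e. \<not> merging 3 n (play ?\<sigma> \<chi> t) e"
      using merging_strategy_reaches_stuck[OF \<chi> \<open>0 < n\<close>] by blast
    let ?h = "play ?\<sigma> \<chi> t"
    have "\<exists>i\<in>{1..3}. color_comp ?h i u = color_comp ?h i v" if "u \<in> {..<n}" "v \<in> {..<n}" for u v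
    proof (cases "u = v")
      case True
      then show ?thesis by (intro bexI[of _ 1]) auto
    next
      case False
      then show ?thesis using stuck that by (auto simp: merging_def)
    qed
    then obtain i u where iu: "i \<in> {1..3}" "u < n" "k n \<le> card {v \<in> {..<n}. color_comp ?h i v = color_comp ?h i u}"
      using ex_large_class[of "{..<n}" "color_comp ?h"] assms by (auto simp: lessThan_empty_iff)
    have edges: "e \<in> all_edges {..<n}" if "(e, j) \<in> set ?h" for e j
      using that legal by (auto simp: set_play)
    have "{v \<in> {..<n}. color_comp ?h i v = color_comp ?h i u} \<subseteq> color_comp ?h i u"
      by (auto simp: color_comp_def)
    moreover have "finite (color_comp ?h i u)"
      by (rule finite_subset[OF color_comp_subset[OF edges iu(2)] finite_lessThan])
    ultimately have "k n \<le> card (color_comp ?h i u)" using iu(3) card_mono order_trans by blast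
    moreover have "1 \<le> k n" using assms by (auto simp: k_altdef)
    ultimately have "won 3 (trees (k n)) n ?h"
      using edges iu(1,2) won_of_large_comp[of ?h n i 3 u "k n"] by blast
    then show ?thesis using t legal by (intro exI[of _ t]) auto
  qed
  then have "builder_wins_within 3 (trees (k n)) n (5 * (n - 1))"
    unfolding builder_wins_within_def by blast
  then show ?thesis
    unfolding restricted_online_ramsey_def by (intro INF_lower) simp
qed

end
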